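(* Let $K$ be a field of characteristic zero. For each integer $n>0$ let $$\mathcal{T}_n=M_\infty(K)+\operatorname{Span}_K\{S_{in}: i\in\mathbb{Z}\}\subseteq \mathrm{B}(K),$$ and let $$\mathcal{T}_0=M_\infty(K)+\operatorname{Span}_K\{D_2^{\,n}: n\in\mathbb{Z}\}\subseteq \mathrm{B}(K).$$ Then for every $i\ge 0$, $\mathcal{T}_i$ is a $K$-algebra which contains $M_\infty(K)$ as a faithful ideal and fits in a short exact sequence of $K$-algebras $0\to M_\infty(K)\to\mathcal{T}_i\to K[x,x^{-1}]\to 0$. Moreover, the algebras $\mathcal{T}_i$, $i\ge 0$, are pairwise non-isomorphic.
   Context: $\mathbb{Z}^+$ denotes the positive integers. $\mathrm{B}(K)$ is the unital $K$-algebra of $\mathbb{Z}^+\times\mathbb{Z}^+$ matrices over $K$ with only finitely many nonzero entries in each row and each column. $M_\infty(K)$ is the ideal of $\mathrm{B}(K)$ of matrices with only finitely many nonzero entries, with standard matrix units $e_{ij}$. For each integer $i$, the shift matrix is $S_i=\sum_{j} e_{i+j,j}$, the sum being over all $j\in\mathbb{Z}^+$ with $j>-i$. $D_2=\operatorname{diag}(1,2,4,\ldots,2^{i-1},\ldots)$, so that $D_2^{\,n}=\operatorname{diag}(1,2^n,\ldots,2^{n(i-1)},\ldots)$ for $n\in\mathbb{Z}$. $K[x,x^{-1}]$ is the algebra of Laurent polynomials. A two-sided ideal $I$ of an algebra $E$ is faithful if $aI=\{0\}$ implies $a=0$ and $Ib=\{0\}$ implies $b=0$. *)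

theory Defs
  imports
    "HOL-Algebra.Algebra"
    "HOL-Algebra.Algebraic_Closure_Type"
    "HOL-Library.Function_Algebras"
    "HOL-Library.Poly_Mapping"
begin

section \<open>Associative algebras, ideals and exact sequences\<close>

text \<open>The library locale \<open>algebra\<close> is restricted to commutative algebras.\<close>

definition assoc_algebra :: "('a, 'm) ring_scheme \<Rightarrow> ('a, 'b) module \<Rightarrow> bool" where
  "assoc_algebra K A \<longleftrightarrow>
     Module.module K A \<and> ring A \<and>
     (\<forall>c\<in>carrier K. \<forall>x\<in>carrier A. \<forall>y\<in>carrier A.
        (c \<odot>\<^bsub>A\<^esub> x) \<otimes>\<^bsub>A\<^esub> y = c \<odot>\<^bsub>A\<^esub> (x \<otimes>\<^bsub>A\<^esub> y) \<and>
        x \<otimes>\<^bsub>A\<^esub> (c \<odot>\<^bsub>A\<^esub> y) = c \<odot>\<^bsub>A\<^esub> (x \<otimes>\<^bsub>A\<^esub> y))"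

text \<open>
  Homomorphisms are not required to preserve units, because one of the algebras below has none.
  Between unital algebras a surjective homomorphism preserves the unit automatically.
\<close>

definition alg_hom ::
    "('a, 'm) ring_scheme \<Rightarrow> ('a, 'b) module \<Rightarrow> ('a, 'c) module \<Rightarrow> ('b \<Rightarrow> 'c) set" where
  "alg_hom K A B =
     {h. h \<in> hom (add_monoid A) (add_monoid B) \<and> h \<in> hom A B \<and>
         (\<forall>c\<in>carrier K. \<forall>x\<in>carrier A. h (c \<odot>\<^bsub>A\<^esub> x) = c \<odot>\<^bsub>B\<^esub> h x)}"

definition alg_isomorphic ::
    "('a, 'm) ring_scheme \<Rightarrow> ('a, 'b) module \<Rightarrow> ('a, 'c) module \<Rightarrow> bool" where
  "alg_isomorphic K A B \<longleftrightarrow> (\<exists>h\<in>alg_hom K A B. bij_betw h (carrier A) (carrier B))"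

definition alg_ideal ::
    "('a, 'm) ring_scheme \<Rightarrow> 'b set \<Rightarrow> ('a, 'b) module \<Rightarrow> bool" where
  "alg_ideal K I E \<longleftrightarrow> ideal I E \<and> submodule I K E"

definition faithful_ideal ::
    "('a, 'm) ring_scheme \<Rightarrow> 'b set \<Rightarrow> ('a, 'b) module \<Rightarrow> bool" where
  "faithful_ideal K I E \<longleftrightarrow>
     alg_ideal K I E \<and>
     (\<forall>a\<in>carrier E. (\<forall>x\<in>I. a \<otimes>\<^bsub>E\<^esub> x = \<zero>\<^bsub>E\<^esub>) \<longrightarrow> a = \<zero>\<^bsub>E\<^esub>) \<and>
     (\<forall>b\<in>carrier E. (\<forall>x\<in>I. x \<otimes>\<^bsub>E\<^esub> b = \<zero>\<^bsub>E\<^esub>) \<longrightarrow> b = \<zero>\<^bsub>E\<^esub>)"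

text \<open>\<open>0 \<rightarrow> I \<rightarrow> E \<rightarrow> Q \<rightarrow> 0\<close> with maps \<open>f : I \<rightarrow> E\<close> and \<open>g : E \<rightarrow> Q\<close>.\<close>

definition short_exact ::
    "('a, 'm) ring_scheme \<Rightarrow> ('a, 'b) module \<Rightarrow> ('b \<Rightarrow> 'c) \<Rightarrow> ('a, 'c) module
      \<Rightarrow> ('c \<Rightarrow> 'd) \<Rightarrow> ('a, 'd) module \<Rightarrow> bool" where
  "short_exact K I f E g Q \<longleftrightarrow>
     f \<in> alg_hom K I E \<and> g \<in> alg_hom K E Q \<and>
     inj_on f (carrier I) \<and>
     f ` carrier I = a_kernel E Q g \<and>
     g ` carrier E = carrier Q"


section \<open>Infinite matrices\<close>

text \<open>
  Rows and columns are numbered from 0, so the entry written \<open>(i, j)\<close> with positive integers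
  \<open>i, j\<close> in the literature is \<open>A (i - 1) (j - 1)\<close> here.  Addition and zero of matrices are the
  pointwise ones of \<open>Function_Algebras\<close>; the pointwise product and unit provided there are not
  the matrix ones and are not used.
\<close>

type_synonym 'a infmat = "nat \<Rightarrow> nat \<Rightarrow> 'a"

definition mat_scale :: "'a::field \<Rightarrow> 'a infmat \<Rightarrow> 'a infmat" where
  "mat_scale c A = (\<lambda>i j. c * A i j)"

definition mat_mult :: "'a::field infmat \<Rightarrow> 'a infmat \<Rightarrow> 'a infmat" where
  "mat_mult A B = (\<lambda>i j. \<Sum>k | A i k \<noteq> 0. A i k * B k j)"

definition mat_one :: "'a::field infmat" where
  "mat_one = (\<lambda>i j. if i = j then 1 else 0)"

text \<open>The algebra \<open>B(K)\<close> of row- and column-finite matrices.\<close>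

definition RCF :: "('a::field, 'a infmat) module" where
  "RCF = \<lparr>carrier = {A. (\<forall>i. finite {j. A i j \<noteq> 0}) \<and> (\<forall>j. finite {i. A i j \<noteq> 0})},
          monoid.mult = mat_mult, monoid.one = mat_one, ring.zero = 0, ring.add = (+), module.smult = mat_scale\<rparr>"

definition M_inf :: "'a::field infmat set" where
  "M_inf = {A. finite {(i, j). A i j \<noteq> 0}}"

text \<open>
  \<open>M_inf\<close> with the operations of \<open>RCF\<close>.  It has no unit: the \<open>one\<close> field of this record lies
  outside the carrier.
\<close>

definition M_inf_alg :: "('a::field, 'a infmat) module" where
  "M_inf_alg = RCF\<lparr>carrier := M_inf\<rparr>"

text \<open>
  The shift \<open>S\<^sub>n\<close> is the sum of the matrix units at position \<open>(n + j, j)\<close>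
  over all \<open>j \<ge> 1\<close> with \<open>n + j \<ge> 1\<close>.
\<close>

definition shift :: "int \<Rightarrow> 'a::field infmat" where
  "shift n = (\<lambda>i j. if int i = n + int j then 1 else 0)"

text \<open>The power \<open>D\<^sub>2\<^sup>n\<close>, that is, \<open>diag(1, 2\<^sup>n, 4\<^sup>n, \<dots>)\<close>, for an arbitrary integer \<open>n\<close>.\<close>

definition D2_pow :: "int \<Rightarrow> 'a::field infmat" where
  "D2_pow n = (\<lambda>i j. if i = j then 2 powi (n * int i) else 0)"

definition T_alg :: "nat \<Rightarrow> ('a::field, 'a infmat) module" where
  "T_alg n = RCF\<lparr>carrier :=
     M_inf <+>\<^bsub>RCF\<^esub>
     Modules.module.span mat_scale
       (if n = 0 then range D2_pow else range (\<lambda>i. shift (i * int n)))\<rparr>"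


section \<open>Laurent polynomials\<close>

text \<open>
  Finitely supported functions from the integers to \<open>K\<close> with convolution as product;
  \<open>Poly_Mapping.single n c\<close> is the monomial \<open>c x\<^sup>n\<close>.
\<close>

definition laurent_alg :: "('a::field, int \<Rightarrow>\<^sub>0 'a) module" where
  "laurent_alg = \<lparr>carrier = UNIV, monoid.mult = (*), monoid.one = 1, ring.zero = 0, ring.add = (+),
                  module.smult = (\<lambda>c. Poly_Mapping.map ((*) c))\<rparr>"

end

theory Submission
  imports Defs
begin

text \<open>
  All the algebras have the form \<open>M_inf + span {B k | k}\<close> for a family of matrices \<open>B k\<close>,
  \<open>k \<in> \<int>\<close>: for \<open>n > 0\<close> the shifts \<open>S\<close> by multiples of \<open>n\<close>, for \<open>n = 0\<close> the powers of \<open>D\<^sub>2\<close>.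
  In both cases \<open>B k B l\<close> agrees with \<open>B (k + l)\<close> up to a finite matrix, and no nontrivial linear
  combination of the \<open>B k\<close> is finite (for the powers of \<open>D\<^sub>2\<close> because geometric sequences with
  distinct ratios \<open>2\<^sup>k\<close> are independent, even after finitely many terms are dropped).  So an element
  of the algebra has a well-defined symbol, the Laurent polynomial \<open>p\<close> with
  \<open>x - (\<Sum>k. p\<^sub>k B k)\<close> finite, and the symbol map is the surjection onto the Laurent
  polynomials with kernel \<open>M_inf\<close>.  \<open>M_inf\<close> is faithful because multiplying by matrix units
  reads off the entries.

  The algebras are told apart by a Fredholm index, expressed through the trace of finite matrices.
  For \<open>y x = 1\<close> the matrix \<open>y x - x y = 1 - x y\<close> is idempotent; when it is finite, its trace is
  its rank, which is minus the index of \<open>x\<close>.  Two things have to be seen.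

  First, the set of these traces is an isomorphism invariant.  Every nonzero ideal contains
  all matrix units, hence an isomorphism \<open>h\<close> maps \<open>M_inf\<close> onto itself (\<open>image_M_inf\<close>).  The functional
  \<open>tr (h x)\<close> vanishes on commutators of finite matrices, so it is a multiple of the trace; the factor
  is the trace of \<open>h e\<close> for a corner unit \<open>e\<close>, and it equals 1 since \<open>h e\<close> spans its own corner
  and is therefore an idempotent of rank one (\<open>trace_image_corner\<close>, \<open>trace_image\<close>).

  Second, for the parameter \<open>n\<close> the traces are multiples of \<open>n\<close>, and \<open>n\<close> occurs (\<open>index_multiple\<close>,
  \<open>index_attained\<close>).  The trace of a commutator depends only on the symbols, because the trace of
  a commutator with a finite matrix is 0; the symbol of a one-sided invertible element is a unit,
  hence a monomial of some degree \<open>k\<close>; and the commutator of \<open>B (- k)\<close> and \<open>B k\<close> has trace \<open>k n\<close>.  Since the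
  field has characteristic zero, an isomorphism between the algebras with parameters \<open>m\<close> and \<open>n\<close>
  gives \<open>n dvd m\<close> and \<open>m dvd n\<close>, so \<open>m = n\<close>.
\<close>

section \<open>Arithmetic of row- and column-finite matrices\<close>

notation mat_mult (infixl \<open>\<bullet>\<close> 70)

lemma RCF_iff:
  "A \<in> carrier RCF \<longleftrightarrow> (\<forall>i. finite {j. A i j \<noteq> 0}) \<and> (\<forall>j. finite {i. A i j \<noteq> 0})"
  by (simp add: RCF_def)

lemma RCF_finite_row: "A \<in> carrier RCF \<Longrightarrow> finite {j. A i j \<noteq> 0}"
  and RCF_finite_col: "A \<in> carrier RCF \<Longrightarrow> finite {i. A i j \<noteq> 0}"
  by (simp_all add: RCF_iff)

lemma mat_mult_eq_sum:
  assumes "A \<in> carrier RCF" "finite S" "\<And>k. k \<notin> S \<Longrightarrow> A i k * B k j = 0"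
  shows "(A \<bullet> B) i j = (\<Sum>k\<in>S. A i k * B k j)"
proof -
  have fin: "finite {k. A i k \<noteq> 0}"
    using assms(1) by (rule RCF_finite_row)
  have "(A \<bullet> B) i j = (\<Sum>k\<in>{k. A i k \<noteq> 0} \<union> S. A i k * B k j)"
    unfolding mat_mult_def by (rule sum.mono_neutral_left) (use assms(2) fin in auto)
  also have "\<dots> = (\<Sum>k\<in>S. A i k * B k j)"
    by (rule sum.mono_neutral_right) (use assms fin in auto)
  finally show ?thesis .
qed

lemma mat_mult_nonzeroD: "(A \<bullet> B) i j \<noteq> 0 \<Longrightarrow> \<exists>k. A i k \<noteq> 0 \<and> B k j \<noteq> 0"
  unfolding mat_mult_def by (metis (mono_tags, lifting) mem_Collect_eq mult_zero_right sum.neutral)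

lemma RCF_zero [simp]: "0 \<in> carrier RCF"
  by (simp add: RCF_iff)

lemma RCF_one [simp]: "mat_one \<in> carrier RCF"
  by (simp add: RCF_iff mat_one_def)

lemma RCF_add [simp]:
  assumes "A \<in> carrier RCF" "B \<in> carrier RCF"
  shows "A + B \<in> carrier RCF"
proof -
  have "finite {j. A i j + B i j \<noteq> 0}" for i
    by (rule finite_subset[of _ "{j. A i j \<noteq> 0} \<union> {j. B i j \<noteq> 0}"])
       (use assms in \<open>auto simp: RCF_finite_row\<close>)
  moreover have "finite {i. A i j + B i j \<noteq> 0}" for j
    by (rule finite_subset[of _ "{i. A i j \<noteq> 0} \<union> {i. B i j \<noteq> 0}"])
       (use assms in \<open>auto simp: RCF_finite_col\<close>)
  ultimately show ?thesis
    by (simp add: RCF_iff)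
qed

lemma RCF_scale [simp]:
  assumes "A \<in> carrier RCF"
  shows "mat_scale c A \<in> carrier RCF"
  using assms by (auto simp: RCF_iff mat_scale_def)

lemma RCF_mult [simp]:
  assumes "A \<in> carrier RCF" "B \<in> carrier RCF"
  shows "A \<bullet> B \<in> carrier RCF"
proof -
  have "finite {j. (A \<bullet> B) i j \<noteq> 0}" for i
    by (rule finite_subset[of _ "\<Union>k\<in>{k. A i k \<noteq> 0}. {j. B k j \<noteq> 0}"])
       (use assms in \<open>auto simp: RCF_finite_row dest: mat_mult_nonzeroD\<close>)
  moreover have "finite {i. (A \<bullet> B) i j \<noteq> 0}" for j
    by (rule finite_subset[of _ "\<Union>k\<in>{k. B k j \<noteq> 0}. {i. A i k \<noteq> 0}"])
       (use assms in \<open>auto simp: RCF_finite_col dest: mat_mult_nonzeroD\<close>)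
  ultimately show ?thesis
    by (simp add: RCF_iff)
qed

lemma mat_mult_assoc:
  assumes A: "A \<in> carrier RCF" and B: "B \<in> carrier RCF"
  shows "(A \<bullet> B) \<bullet> C = A \<bullet> (B \<bullet> C)"
proof (intro ext)
  fix i j
  let ?K = "{k. A i k \<noteq> 0}"
  let ?L = "\<Union>k\<in>?K. {l. B k l \<noteq> 0}"
  have K: "finite ?K" and L: "finite ?L"
    using A B by (auto simp: RCF_finite_row)
  have "((A \<bullet> B) \<bullet> C) i j = (\<Sum>l\<in>?L. (A \<bullet> B) i l * C l j)"
    by (rule mat_mult_eq_sum) (use A B L in \<open>auto dest: mat_mult_nonzeroD\<close>)
  also have "\<dots> = (\<Sum>l\<in>?L. \<Sum>k\<in>?K. A i k * B k l * C l j)"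
    by (simp add: mat_mult_def sum_distrib_right)
  also have "\<dots> = (\<Sum>k\<in>?K. \<Sum>l\<in>?L. A i k * (B k l * C l j))"
    by (subst sum.swap) (simp add: mult.assoc)
  also have "\<dots> = (\<Sum>k\<in>?K. A i k * (B \<bullet> C) k j)"
  proof (rule sum.cong)
    fix k assume "k \<in> ?K"
    then have "(B \<bullet> C) k j = (\<Sum>l\<in>?L. B k l * C l j)"
      by (intro mat_mult_eq_sum) (use B L in auto)
    then show "(\<Sum>l\<in>?L. A i k * (B k l * C l j)) = A i k * (B \<bullet> C) k j"
      by (simp add: sum_distrib_left)
  qed simp
  also have "\<dots> = (A \<bullet> (B \<bullet> C)) i j"
    by (simp add: mat_mult_def)
  finally show "((A \<bullet> B) \<bullet> C) i j = (A \<bullet> (B \<bullet> C)) i j" .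
qed

lemma mat_mult_add_right: "A \<bullet> (B + C) = A \<bullet> B + A \<bullet> C"
  by (intro ext) (simp add: mat_mult_def algebra_simps sum.distrib)

text \<open>
  The sum that defines a product runs over the support of a row of the left factor.  The three
  products here are therefore sums over different index sets; finite rows provide a common one.
\<close>

lemma mat_mult_add_left:
  assumes "A \<in> carrier RCF" "B \<in> carrier RCF"
  shows "(A + B) \<bullet> C = A \<bullet> C + B \<bullet> C"
proof (intro ext)
  fix i j
  let ?K = "{k. A i k \<noteq> 0} \<union> {k. B i k \<noteq> 0}"
  have K: "finite ?K"
    using assms by (simp add: RCF_finite_row)
  have "(Y \<bullet> C) i j = (\<Sum>k\<in>?K. Y i k * C k j)" if "Y \<in> {A, B, A + B}" for Y
    by (rule mat_mult_eq_sum) (use that assms K in auto)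
  then show "((A + B) \<bullet> C) i j = (A \<bullet> C + B \<bullet> C) i j"
    by (simp add: sum.distrib algebra_simps)
qed

lemma mat_mult_scale_right [simp]: "A \<bullet> mat_scale c B = mat_scale c (A \<bullet> B)"
  by (intro ext) (simp add: mat_mult_def mat_scale_def sum_distrib_left mult.left_commute)

lemma mat_mult_scale_left [simp]: "mat_scale c A \<bullet> B = mat_scale c (A \<bullet> B)"
  by (cases "c = 0") (auto simp: mat_mult_def mat_scale_def sum_distrib_left mult.assoc intro!: ext)

lemma mat_mult_one_right [simp]: "A \<in> carrier RCF \<Longrightarrow> A \<bullet> mat_one = A"
  by (intro ext, subst mat_mult_eq_sum[where S = "{_}"]) (auto simp: mat_one_def)

lemma mat_mult_one_left [simp]: "mat_one \<bullet> A = A"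
proof (intro ext)
  fix i j
  have "(mat_one \<bullet> A) i j = (\<Sum>k\<in>{i}. mat_one i k * A k j)"
    by (rule mat_mult_eq_sum) (simp_all, simp add: mat_one_def)
  then show "(mat_one \<bullet> A) i j = A i j"
    by (simp add: mat_one_def)
qed

lemma mat_mult_zero_left [simp]: "0 \<bullet> A = 0"
  and mat_mult_zero_right [simp]: "A \<bullet> 0 = 0"
  by (simp_all add: mat_mult_def fun_eq_iff)

lemma mat_scale_simps [simp]:
  "mat_scale 1 A = A" "mat_scale 0 A = 0" "mat_scale c 0 = 0"
  "mat_scale c (mat_scale d A) = mat_scale (c * d) A"
  by (simp_all add: mat_scale_def fun_eq_iff)

lemma mat_scale_add: "mat_scale c (A + B) = mat_scale c A + mat_scale c B"
  and mat_scale_add_left: "mat_scale (c + d) A = mat_scale c A + mat_scale d A"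
  and minus_eq_mat_scale: "- A = mat_scale (- 1) A"
  and diff_eq_mat_scale: "A - B = A + mat_scale (- 1) B"
  by (simp_all add: mat_scale_def fun_eq_iff algebra_simps)

text \<open>
  Inductions over finite sums leave matrices eta-expanded, and these rules then push sums of
  matrices into their entries, out of reach of the rules about matrices.
\<close>

lemmas pointwise = plus_fun_apply zero_fun_apply minus_apply

lemma sum_infmat_apply: "(sum f F) i j = (\<Sum>x\<in>F. f x i j)" for f :: "'b \<Rightarrow> 'a::field infmat"
  by (induction F rule: infinite_finite_induct) auto

lemma mat_scale_sum: "mat_scale c (sum f F) = (\<Sum>k\<in>F. mat_scale c (f k))"
  by (induction F rule: infinite_finite_induct) (simp_all add: mat_scale_add del: pointwise)

lemma RCF_diff [simp]: "A \<in> carrier RCF \<Longrightarrow> B \<in> carrier RCF \<Longrightarrow> A - B \<in> carrier RCF"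
  by (simp add: diff_eq_mat_scale)

lemma mat_mult_diff_right: "A \<bullet> (B - C) = A \<bullet> B - A \<bullet> C"
  by (simp add: diff_eq_mat_scale mat_mult_add_right)

lemma mat_mult_diff_left: "A \<in> carrier RCF \<Longrightarrow> B \<in> carrier RCF \<Longrightarrow> (A - B) \<bullet> C = A \<bullet> C - B \<bullet> C"
  by (simp add: diff_eq_mat_scale mat_mult_add_left)

section \<open>Finite matrices\<close>

lemma M_inf_iff_bound: "A \<in> M_inf \<longleftrightarrow> (\<exists>N. \<forall>i j. A i j \<noteq> 0 \<longrightarrow> i < N \<and> j < N)"
proof
  assume "A \<in> M_inf"
  then have fin: "finite {(i, j). A i j \<noteq> 0}"
    by (simp add: M_inf_def)
  let ?X = "fst ` {(i, j). A i j \<noteq> 0} \<union> snd ` {(i, j). A i j \<noteq> 0}"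
  have "finite ?X"
    using fin by blast
  then obtain N where "\<forall>x\<in>?X. x < N"
    using finite_nat_set_iff_bounded by blast
  then have "\<forall>i j. A i j \<noteq> 0 \<longrightarrow> i < N \<and> j < N"
    by force
  then show "\<exists>N. \<forall>i j. A i j \<noteq> 0 \<longrightarrow> i < N \<and> j < N" ..
next
  assume "\<exists>N. \<forall>i j. A i j \<noteq> 0 \<longrightarrow> i < N \<and> j < N"
  then obtain N where "{(i, j). A i j \<noteq> 0} \<subseteq> {..<N} \<times> {..<N}"
    by blast
  then show "A \<in> M_inf"
    unfolding M_inf_def by (auto intro: finite_subset)
qed

lemma M_inf_RCF: "A \<in> M_inf \<Longrightarrow> A \<in> carrier RCF"
proof -
  assume "A \<in> M_inf"
  then obtain N where "\<forall>i j. A i j \<noteq> 0 \<longrightarrow> i < N \<and> j < N"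
    unfolding M_inf_iff_bound ..
  then have "{j. A i j \<noteq> 0} \<subseteq> {..<N}" "{i. A i j \<noteq> 0} \<subseteq> {..<N}" for i j
    by auto
  then show ?thesis
    unfolding RCF_iff by (meson finite_lessThan finite_subset)
qed

lemma M_inf_zero [simp]: "0 \<in> M_inf"
  by (simp add: M_inf_iff_bound)

lemma M_inf_add [simp]:
  assumes "A \<in> M_inf" "B \<in> M_inf"
  shows "A + B \<in> M_inf"
proof -
  obtain M N where "\<forall>i j. A i j \<noteq> 0 \<longrightarrow> i < M \<and> j < M" "\<forall>i j. B i j \<noteq> 0 \<longrightarrow> i < N \<and> j < N"
    using assms M_inf_iff_bound by metis
  then have "\<forall>i j. (A + B) i j \<noteq> 0 \<longrightarrow> i < max M N \<and> j < max M N"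
    by (metis add.right_neutral less_max_iff_disj plus_fun_apply)
  then show ?thesis
    unfolding M_inf_iff_bound by blast
qed

lemma M_inf_scale [simp]: "A \<in> M_inf \<Longrightarrow> mat_scale c A \<in> M_inf"
  unfolding M_inf_iff_bound mat_scale_def by auto

lemma M_inf_uminus [simp]: "A \<in> M_inf \<Longrightarrow> - A \<in> M_inf"
  by (simp add: minus_eq_mat_scale)

lemma M_inf_diff [simp]: "A \<in> M_inf \<Longrightarrow> B \<in> M_inf \<Longrightarrow> A - B \<in> M_inf"
  by (simp add: diff_eq_mat_scale)

lemma M_inf_mult_left [simp]:
  assumes "A \<in> carrier RCF" "B \<in> M_inf"
  shows "A \<bullet> B \<in> M_inf"
proof -
  have "{(i, j). (A \<bullet> B) i j \<noteq> 0} \<subseteq>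
      (\<lambda>((k, j), i). (i, j)) ` (SIGMA (k, j):{(k, j). B k j \<noteq> 0}. {i. A i k \<noteq> 0})"
    by (force dest!: mat_mult_nonzeroD)
  moreover have "finite (SIGMA (k, j):{(k, j). B k j \<noteq> 0}. {i. A i k \<noteq> 0})"
    using assms by (intro finite_SigmaI) (auto simp: M_inf_def RCF_finite_col)
  ultimately show ?thesis
    unfolding M_inf_def by (auto intro: finite_subset)
qed

lemma M_inf_mult_right [simp]:
  assumes "A \<in> M_inf" "B \<in> carrier RCF"
  shows "A \<bullet> B \<in> M_inf"
proof -
  have "{(i, j). (A \<bullet> B) i j \<noteq> 0} \<subseteq>
      (\<lambda>((i, k), j). (i, j)) ` (SIGMA (i, k):{(i, k). A i k \<noteq> 0}. {j. B k j \<noteq> 0})"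
    by (force dest!: mat_mult_nonzeroD)
  moreover have "finite (SIGMA (i, k):{(i, k). A i k \<noteq> 0}. {j. B k j \<noteq> 0})"
    using assms by (intro finite_SigmaI) (auto simp: M_inf_def RCF_finite_row)
  ultimately show ?thesis
    unfolding M_inf_def by (auto intro: finite_subset)
qed

definition mat_unit :: "nat \<Rightarrow> nat \<Rightarrow> 'a::field infmat" where
  "mat_unit p q = (\<lambda>i j. if i = p \<and> j = q then 1 else 0)"

lemma mat_unit_M_inf [simp]: "mat_unit p q \<in> M_inf"
  unfolding M_inf_iff_bound mat_unit_def
  by (rule exI[of _ "Suc (max p q)"]) auto

lemma mat_unit_RCF [simp]: "mat_unit p q \<in> carrier RCF"
  by (rule M_inf_RCF) simp

lemma mat_unit_neq_zero: "mat_unit p q \<noteq> (0 :: 'a::field infmat)"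
proof
  assume "mat_unit p q = (0 :: 'a infmat)"
  then have "mat_unit p q p q = (0 :: 'a infmat) p q"
    by simp
  then show False
    by (simp add: mat_unit_def)
qed

lemma mult_mat_unit:
  "A \<in> carrier RCF \<Longrightarrow> A \<bullet> mat_unit p q = (\<lambda>i j. if j = q then A i p else 0)"
  by (intro ext, subst mat_mult_eq_sum[where S = "{p}"]) (auto simp: mat_unit_def)

lemma mat_unit_mult: "mat_unit p q \<bullet> A = (\<lambda>i j. if i = p then A q j else 0)"
proof (intro ext)
  fix i j
  have "(mat_unit p q \<bullet> A) i j = (\<Sum>k\<in>{q}. mat_unit p q i k * A k j)"
    by (rule mat_mult_eq_sum) (simp_all, simp add: mat_unit_def)
  then show "(mat_unit p q \<bullet> A) i j = (if i = p then A q j else 0)"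
    by (simp add: mat_unit_def)
qed

lemma mat_unit_mult_mat_unit:
  "mat_unit p q \<bullet> mat_unit r s = (if q = r then mat_unit p s else 0)"
  unfolding mat_unit_mult by (auto simp: mat_unit_def fun_eq_iff)

lemma mat_unit_sandwich:
  assumes "A \<in> carrier RCF"
  shows "mat_unit p q \<bullet> A \<bullet> mat_unit r s = mat_scale (A q r) (mat_unit p s)"
proof -
  have "mat_unit p q \<bullet> A \<bullet> mat_unit r s = (\<lambda>i j. if j = s then (mat_unit p q \<bullet> A) i r else 0)"
    using assms by (intro mult_mat_unit) simp
  then show ?thesis
    unfolding mat_unit_mult by (simp add: mat_scale_def mat_unit_def fun_eq_iff)
qed

lemma M_inf_induct [consumes 1, case_names zero add unit]:
  assumes "A \<in> M_inf"
    and zero: "P 0"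
    and add: "\<And>A B. A \<in> M_inf \<Longrightarrow> B \<in> M_inf \<Longrightarrow> P A \<Longrightarrow> P B \<Longrightarrow> P (A + B)"
    and unit: "\<And>c p q. P (mat_scale c (mat_unit p q))"
  shows "P A"
proof -
  let ?X = "{(i, j). A i j \<noteq> 0}"
  define f where "f x = mat_scale (A (fst x) (snd x)) (mat_unit (fst x) (snd x))" for x
  have f: "f x \<in> M_inf" "P (f x)" for x
    by (simp_all add: f_def unit)
  have fin: "finite ?X"
    using assms(1) by (simp add: M_inf_def)
  have "A i j = sum f ?X i j" for i j
  proof -
    have "sum f ?X i j = (\<Sum>x\<in>?X. if x = (i, j) then A i j else 0)"
      unfolding sum_infmat_apply
      by (rule sum.cong) (auto simp: f_def mat_scale_def mat_unit_def split: if_splits)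
    also have "\<dots> = A i j"
      using fin by auto
    finally show ?thesis ..
  qed
  then have A_eq: "A = sum f ?X"
    by (intro ext)
  have "P (sum f F) \<and> sum f F \<in> M_inf" if "finite F" for F
    using that
  proof (induction F)
    case empty
    show ?case
      unfolding sum.empty by (intro conjI zero M_inf_zero)
  next
    case (insert x F)
    show ?case
      unfolding sum.insert[OF insert.hyps]
      using insert.IH by (intro conjI add M_inf_add f) simp_all
  qed
  then have "P (sum f ?X)"
    using fin by blast
  then show ?thesis
    by (rule ssubst[OF A_eq])
qed

section \<open>The trace\<close>

definition mat_trace :: "'a::field infmat \<Rightarrow> 'a" where
  "mat_trace A = (\<Sum>i | A i i \<noteq> 0. A i i)"

lemma mat_trace_eq_sum:
  assumes "finite S" "\<And>i. i \<notin> S \<Longrightarrow> A i i = 0"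
  shows "mat_trace A = (\<Sum>i\<in>S. A i i)"
  unfolding mat_trace_def by (rule sum.mono_neutral_left) (use assms in auto)

lemma M_inf_diagonal: "A \<in> M_inf \<Longrightarrow> finite {i. A i i \<noteq> 0}"
proof -
  assume "A \<in> M_inf"
  then obtain N where "\<forall>i j. A i j \<noteq> 0 \<longrightarrow> i < N \<and> j < N"
    unfolding M_inf_iff_bound ..
  then have "{i. A i i \<noteq> 0} \<subseteq> {..<N}"
    by auto
  then show ?thesis
    by (rule finite_subset) simp
qed

lemma mat_trace_zero [simp]: "mat_trace 0 = 0"
  by (simp add: mat_trace_def)

lemma mat_trace_add:
  assumes "A \<in> M_inf" "B \<in> M_inf"
  shows "mat_trace (A + B) = mat_trace A + mat_trace B"
proof -
  let ?S = "{i. A i i \<noteq> 0} \<union> {i. B i i \<noteq> 0}"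
  have S: "finite ?S"
    using assms by (simp add: M_inf_diagonal)
  have "mat_trace Y = (\<Sum>i\<in>?S. Y i i)" if "Y \<in> {A, B, A + B}" for Y
    by (rule mat_trace_eq_sum) (use that S in auto)
  then show ?thesis
    by (simp add: sum.distrib)
qed

lemma mat_trace_scale: "mat_trace (mat_scale c A) = c * mat_trace A"
  by (cases "c = 0") (auto simp: mat_trace_def mat_scale_def sum_distrib_left)

lemma mat_trace_diff: "A \<in> M_inf \<Longrightarrow> B \<in> M_inf \<Longrightarrow> mat_trace (A - B) = mat_trace A - mat_trace B"
  by (simp add: diff_eq_mat_scale mat_trace_add mat_trace_scale)

lemma mat_trace_unit: "mat_trace (mat_unit p q) = (if p = q then 1 else 0)"
  by (subst mat_trace_eq_sum[of "{p}"]) (auto simp: mat_unit_def)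

text \<open>
  Both traces are the same finite double sum as soon as one factor is finite.  The index below
  needs this with an arbitrary element of the algebra as the other factor.
\<close>

lemma mat_trace_commute:
  assumes "A \<in> M_inf" "B \<in> carrier RCF"
  shows "mat_trace (A \<bullet> B) = mat_trace (B \<bullet> A)"
proof -
  obtain N where N: "\<And>i j. A i j \<noteq> 0 \<Longrightarrow> i < N \<and> j < N"
    using assms(1) M_inf_iff_bound by metis
  then have vanish: "A i j = 0" if "\<not> i < N \<or> \<not> j < N" for i j
    using that by metis
  have "(A \<bullet> B) i j = (\<Sum>k<N. A i k * B k j)" for i j
    by (rule mat_mult_eq_sum) (use assms vanish M_inf_RCF in auto)
  then have "mat_trace (A \<bullet> B) = (\<Sum>i<N. \<Sum>k<N. A i k * B k i)"
    by (subst mat_trace_eq_sum[of "{..<N}"]) (use vanish in \<open>auto intro!: sum.neutral\<close>)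
  also have "\<dots> = (\<Sum>k<N. \<Sum>i<N. B k i * A i k)"
    by (subst sum.swap) (simp add: mult.commute)
  also have "\<dots> = mat_trace (B \<bullet> A)"
  proof -
    have "(B \<bullet> A) k j = (\<Sum>i<N. B k i * A i j)" for k j
      by (rule mat_mult_eq_sum) (use assms vanish in auto)
    then show ?thesis
      by (subst mat_trace_eq_sum[of "{..<N}"]) (use vanish in \<open>auto intro!: sum.neutral\<close>)
  qed
  finally show ?thesis .
qed

section \<open>Subalgebras that contain the finite matrices\<close>

lemma RCF_simps [simp]:
  "x \<otimes>\<^bsub>RCF\<^esub> y = x \<bullet> y" "\<one>\<^bsub>RCF\<^esub> = mat_one" "\<zero>\<^bsub>RCF\<^esub> = 0"
  "x \<oplus>\<^bsub>RCF\<^esub> y = x + y" "c \<odot>\<^bsub>RCF\<^esub> x = mat_scale c x"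
  by (simp_all add: RCF_def)

abbreviation (input) scalars :: "'a::field ring" where
  "scalars \<equiv> ring_of_type_algebra"

lemma scalars_simps [simp]:
  "carrier scalars = UNIV" "x \<otimes>\<^bsub>scalars\<^esub> y = x * y" "\<one>\<^bsub>scalars\<^esub> = 1"
  "x \<oplus>\<^bsub>scalars\<^esub> y = x + y" "\<zero>\<^bsub>scalars\<^esub> = 0"
  by (simp_all add: ring_of_type_algebra_def)

lemma abelian_group_RCF: "abelian_group (RCF :: ('a::field, 'a infmat) module)"
proof (rule abelian_groupI)
  fix x :: "'a infmat" assume "x \<in> carrier RCF"
  then show "\<exists>y\<in>carrier RCF. y \<oplus>\<^bsub>RCF\<^esub> x = \<zero>\<^bsub>RCF\<^esub>"
    by (intro bexI[of _ "mat_scale (- 1) x"]) (simp flip: minus_eq_mat_scale, simp)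
qed (simp_all add: ac_simps)

lemma ring_RCF: "ring (RCF :: ('a::field, 'a infmat) module)"
  by (intro ringI abelian_group_RCF monoidI)
     (simp_all add: mat_mult_assoc mat_mult_add_left mat_mult_add_right)

lemma module_RCF: "Module.module scalars (RCF :: ('a::field, 'a infmat) module)"
  by (intro Module.moduleI abelian_group_RCF cring_from_type_algebra)
     (simp_all add: mat_scale_add mat_scale_add_left)

lemma RCF_a_inv: "x \<in> carrier RCF \<Longrightarrow> \<ominus>\<^bsub>RCF\<^esub> x = - x"
proof -
  assume x: "x \<in> carrier RCF"
  interpret ring "RCF :: ('a::field, 'a infmat) module"
    by (rule ring_RCF)
  have "- x \<in> carrier RCF"
    unfolding minus_eq_mat_scale using x by (rule RCF_scale)
  then show ?thesis
    using x by (intro minus_equality) simp_all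
qed

text \<open>
  Faithfulness of \<open>M_inf\<close> and the behaviour of isomorphisms depend on nothing but these closure
  properties; the description by Laurent polynomials enters only later.
\<close>

locale matrix_algebra =
  fixes T :: "'a::field infmat set"
  assumes sub_RCF: "T \<subseteq> carrier RCF"
    and M_inf_sub: "M_inf \<subseteq> T"
    and one_mem: "mat_one \<in> T"
    and add_mem: "x \<in> T \<Longrightarrow> y \<in> T \<Longrightarrow> x + y \<in> T"
    and mult_mem: "x \<in> T \<Longrightarrow> y \<in> T \<Longrightarrow> x \<bullet> y \<in> T"
    and scale_mem: "x \<in> T \<Longrightarrow> mat_scale c x \<in> T"
begin

abbreviation alg :: "('a, 'a infmat) module" where
  "alg \<equiv> RCF\<lparr>carrier := T\<rparr>"

lemma mem_RCF [simp]: "x \<in> T \<Longrightarrow> x \<in> carrier RCF"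
  and M_inf_mem [simp]: "x \<in> M_inf \<Longrightarrow> x \<in> T"
  using sub_RCF M_inf_sub by auto

lemma uminus_mem: "x \<in> T \<Longrightarrow> - x \<in> T"
  by (simp add: minus_eq_mat_scale scale_mem)

lemma subring: "subring T RCF"
  using ring.subringI[OF ring_RCF sub_RCF]
  by (simp add: one_mem add_mem mult_mem RCF_a_inv uminus_mem)

lemma ring_alg: "ring alg"
  by (rule ring.subring_is_ring[OF ring_RCF subring])

lemma submodule: "submodule T scalars RCF"
  by (intro module.module_incl_imp_submodule[OF module_RCF])
     (auto intro!: Module.moduleI cring_from_type_algebra ring.is_abelian_group ring_alg abelian_group.axioms
        simp: scale_mem mat_scale_add mat_scale_add_left)

lemma module_alg: "Module.module scalars alg"
  by (rule submodule.submodule_is_module[OF submodule module_RCF])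

lemma assoc_algebra: "assoc_algebra scalars alg"
  unfolding assoc_algebra_def by (simp add: module_alg ring_alg)

lemma a_inv_alg: "x \<in> T \<Longrightarrow> \<ominus>\<^bsub>alg\<^esub> x = - x"
proof -
  assume x: "x \<in> T"
  interpret ring alg by (rule ring_alg)
  show ?thesis
    by (rule minus_equality) (use x in \<open>simp_all add: uminus_mem\<close>)
qed

lemma subgroup_M_inf: "subgroup M_inf (add_monoid alg)"
proof -
  interpret ring alg by (rule ring_alg)
  show ?thesis
  proof (rule add.subgroupI)
    fix x :: "'a infmat" assume "x \<in> M_inf"
    then show "\<ominus>\<^bsub>alg\<^esub> x \<in> M_inf"
      by (simp add: a_inv_alg)
  next
    show "M_inf \<noteq> {}"
      using M_inf_zero by blast
  qed auto
qed

lemma alg_ideal_M_inf: "alg_ideal scalars M_inf alg"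
proof -
  have "submodule M_inf scalars alg"
    using subgroup_M_inf by (auto intro!: submodule.intro submodule_axioms.intro)
  moreover have "ideal M_inf alg"
    by (intro idealI ring_alg subgroup_M_inf) auto
  ultimately show ?thesis
    by (simp add: alg_ideal_def)
qed

lemma faithful_M_inf: "faithful_ideal scalars M_inf alg"
proof -
  have left: "a = 0" if a: "a \<in> T" "\<forall>x\<in>M_inf. a \<bullet> x = 0" for a
  proof (intro ext)
    fix i j
    have "(a \<bullet> mat_unit j j) i j = a i j"
      using a(1) by (simp add: mult_mat_unit)
    then show "a i j = 0 i j"
      using a(2) by simp
  qed
  have right: "b = 0" if b: "b \<in> T" "\<forall>x\<in>M_inf. x \<bullet> b = 0" for b
  proof (intro ext)
    fix i j
    have "(mat_unit i i \<bullet> b) i j = b i j"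
      by (simp add: mat_unit_mult)
    then show "b i j = 0 i j"
      using b(2) by simp
  qed
  show ?thesis
    unfolding faithful_ideal_def
  proof (intro conjI ballI impI alg_ideal_M_inf)
    fix a assume "a \<in> carrier alg" "\<forall>x\<in>M_inf. a \<otimes>\<^bsub>alg\<^esub> x = \<zero>\<^bsub>alg\<^esub>"
    then show "a = \<zero>\<^bsub>alg\<^esub>"
      using left[of a] by simp
  next
    fix b assume "b \<in> carrier alg" "\<forall>x\<in>M_inf. x \<otimes>\<^bsub>alg\<^esub> b = \<zero>\<^bsub>alg\<^esub>"
    then show "b = \<zero>\<^bsub>alg\<^esub>"
      using right[of b] by simp
  qed
qed

end

section \<open>Isomorphisms preserve finite matrices and their traces\<close>

locale matrix_algebra_iso =
  S: matrix_algebra S + T: matrix_algebra T for S T :: "'a::field infmat set" +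
  fixes h :: "'a infmat \<Rightarrow> 'a infmat"
  assumes bij: "bij_betw h S T"
    and h_add: "x \<in> S \<Longrightarrow> y \<in> S \<Longrightarrow> h (x + y) = h x + h y"
    and h_mult: "x \<in> S \<Longrightarrow> y \<in> S \<Longrightarrow> h (x \<bullet> y) = h x \<bullet> h y"
    and h_scale: "x \<in> S \<Longrightarrow> h (mat_scale c x) = mat_scale c (h x)"
begin

lemma h_mem: "x \<in> S \<Longrightarrow> h x \<in> T"
  using bij bij_betwE by blast

lemma h_surj: "y \<in> T \<Longrightarrow> \<exists>x\<in>S. y = h x"
  using bij by (auto simp: bij_betw_def)

lemma h_inj: "x \<in> S \<Longrightarrow> y \<in> S \<Longrightarrow> h x = h y \<longleftrightarrow> x = y"
  using bij by (auto simp: bij_betw_def inj_on_def)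

lemma h_zero: "h 0 = 0"
  using h_scale[of 0 0] by simp

lemma h_diff: "x \<in> S \<Longrightarrow> y \<in> S \<Longrightarrow> h (x - y) = h x - h y"
  by (simp add: diff_eq_mat_scale h_add h_scale S.scale_mem)

lemma h_one: "h mat_one = mat_one"
proof -
  obtain u where u: "u \<in> S" "mat_one = h u"
    using h_surj T.one_mem by blast
  have "h mat_one = h mat_one \<bullet> h u"
    using h_mem[OF S.one_mem] u(2) by (metis T.mem_RCF mat_mult_one_right)
  also have "\<dots> = h u"
    using u(1) S.one_mem by (simp flip: h_mult)
  finally show ?thesis
    using u(2) by simp
qed

text \<open>
  The image of \<open>M_inf\<close> is a nonzero ideal.  From a nonzero entry of one of its elements,
  multiplication by matrix units on both sides produces every matrix unit.
\<close>

lemma M_inf_subset_image: "M_inf \<subseteq> h ` M_inf"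
proof
  fix y :: "'a infmat" assume "y \<in> M_inf"
  then show "y \<in> h ` M_inf"
  proof (induction y rule: M_inf_induct)
    case zero
    show ?case
      using h_zero M_inf_zero by (metis image_eqI)
  next
    case (add A B)
    then obtain x x' where "x \<in> M_inf" "x' \<in> M_inf" "A = h x" "B = h x'"
      by blast
    then have "x + x' \<in> M_inf" "A + B = h (x + x')"
      by (simp_all add: h_add)
    then show ?case
      by blast
  next
    case (unit c p q)
    let ?e = "mat_unit 0 0 :: 'a infmat"
    have e: "?e \<in> S" by simp
    have "h ?e \<noteq> 0"
      using h_inj[of ?e 0] h_zero mat_unit_neq_zero by simp
    then obtain i j where ij: "h ?e i j \<noteq> 0"
      by (auto simp: fun_eq_iff)
    obtain u v where u: "u \<in> S" "mat_unit p i = h u" and v: "v \<in> S" "mat_unit j q = h v"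
      using h_surj by (metis T.M_inf_mem mat_unit_M_inf)
    \<comment> \<open>The preimage lies in \<open>M_inf\<close> because its middle factor does.\<close>
    let ?x = "mat_scale (c / h ?e i j) (u \<bullet> ?e \<bullet> v)"
    have "h ?x = mat_scale (c / h ?e i j) (mat_unit p i \<bullet> h ?e \<bullet> mat_unit j q)"
      using u v e by (simp add: h_scale h_mult S.mult_mem)
    also have "\<dots> = mat_scale c (mat_unit p q)"
      using ij by (simp add: mat_unit_sandwich h_mem)
    finally show ?case
      using u(1) v(1) by (intro image_eqI[of _ _ ?x]) simp_all
  qed
qed

lemma inverse: "matrix_algebra_iso T S (inv_into S h)"
proof -
  let ?g = "inv_into S h"
  have g: "?g y \<in> S" "h (?g y) = y" if "y \<in> T" for y
    using that bij by (auto simp: bij_betw_def inv_into_into f_inv_into_f)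
  have gI: "?g y = x" if "x \<in> S" "y = h x" for x y
    using that bij by (auto simp: bij_betw_def)
  show ?thesis
  proof
    show "bij_betw ?g T S"
      using bij by (rule bij_betw_inv_into)
  qed (auto intro!: gI simp: g h_add h_mult h_scale S.add_mem S.mult_mem S.scale_mem)
qed

text \<open>
  The previous inclusion for \<open>h\<close> and for its inverse.
\<close>

lemma image_M_inf: "h ` M_inf = M_inf"
proof
  interpret inv: matrix_algebra_iso T S "inv_into S h"
    by (rule inverse)
  show "h ` M_inf \<subseteq> M_inf"
  proof (rule image_subsetI)
    fix x :: "'a infmat" assume "x \<in> M_inf"
    then obtain y where "y \<in> M_inf" "x = inv_into S h y"
      using inv.M_inf_subset_image by blast
    then show "h x \<in> M_inf"
      using bij by (simp add: bij_betw_def f_inv_into_f)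
  qed
qed (rule M_inf_subset_image)

text \<open>
  With \<open>e\<close> the corner unit, \<open>e A e\<close> is always a multiple of \<open>e\<close>.  This passes to \<open>f = h e\<close>.
  Taking matrix units for \<open>A\<close> shows that all rows of \<open>f\<close> are multiples of one row,
  \<open>f j l = u j * f p l\<close>, and then \<open>f f = f\<close> says exactly that \<open>\<Sum>k. u k * f p k\<close>, the trace
  of \<open>f\<close>, is 1.
\<close>

lemma trace_image_corner: "mat_trace (h (mat_unit 0 0)) = 1"
proof -
  define e :: "'a infmat" where "e = mat_unit 0 0"
  define f where "f = h e"
  have e: "e \<in> S" "e \<in> M_inf" "e \<bullet> e = e"
    by (simp_all add: e_def mat_unit_mult_mat_unit)
  have f: "f \<in> M_inf" "f \<bullet> f = f"
    using e image_M_inf by (auto simp: f_def simp flip: h_mult)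
  note f_RCF = M_inf_RCF[OF f(1)]
  have "f \<noteq> 0"
    using h_inj[of e 0] h_zero mat_unit_neq_zero by (simp add: f_def e_def)
  then obtain p q where pq: "f p q \<noteq> 0"
    by (auto simp: fun_eq_iff)
  have "\<exists>c. f \<bullet> A \<bullet> f = mat_scale c f" if "A \<in> M_inf" for A
  proof -
    have "A \<in> h ` M_inf"
      using that image_M_inf by simp
    then obtain x where x: "x \<in> M_inf" "A = h x"
      by blast
    have "e \<bullet> x \<bullet> e = mat_scale (x 0 0) e"
      using x(1) by (simp add: e_def mat_unit_sandwich M_inf_RCF)
    then have "f \<bullet> A \<bullet> f = h (mat_scale (x 0 0) e)"
      using x e by (simp add: f_def h_mult[symmetric] S.mult_mem)
    then show ?thesis
      using e(1) by (auto simp: h_scale f_def)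
  qed
  then have "\<forall>j. \<exists>c. f \<bullet> mat_unit q j \<bullet> f = mat_scale c f"
    by simp
  then obtain c where c: "\<And>j. f \<bullet> mat_unit q j \<bullet> f = mat_scale (c j) f"
    by (auto dest: choice)
  define u where "u j = c j / f p q" for j
  have rank_one: "f j l = u j * f p l" for j l
  proof -
    have "(f \<bullet> (mat_unit q j \<bullet> f)) p l = (\<Sum>k\<in>{q}. f p k * (mat_unit q j \<bullet> f) k l)"
      by (rule mat_mult_eq_sum) (use f_RCF in \<open>simp_all add: mat_unit_mult\<close>)
    then have "f p q * f j l = c j * f p l"
      using c[of j] f_RCF by (simp add: mat_mult_assoc mat_unit_mult mat_scale_def)
    then show ?thesis
      using pq by (simp add: u_def field_simps)
  qed
  obtain N where N: "\<And>i j. f i j \<noteq> 0 \<Longrightarrow> i < N \<and> j < N"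
    using f(1) M_inf_iff_bound by metis
  then have vanish: "f i j = 0" if "\<not> i < N \<or> \<not> j < N" for i j
    using that by metis
  have "f p q = (f \<bullet> f) p q"
    by (simp add: f(2))
  also have "\<dots> = (\<Sum>k<N. f p k * f k q)"
    by (rule mat_mult_eq_sum) (use f_RCF vanish in auto)
  also have "\<dots> = (\<Sum>k<N. f k k * f p q)"
  proof (rule sum.cong)
    fix k
    have "f p k * f k q = (u k * f p k) * f p q"
      by (subst rank_one[of k q]) simp
    then show "f p k * f k q = f k k * f p q"
      by (simp flip: rank_one)
  qed simp
  also have "\<dots> = mat_trace f * f p q"
    by (subst mat_trace_eq_sum[of "{..<N}"]) (use vanish in \<open>auto simp: sum_distrib_right\<close>)
  finally show ?thesis
    using pq by (simp add: f_def e_def)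
qed

text \<open>
  A functional that vanishes on commutators is determined on matrix units by its value at one corner:
  \<open>e\<^sub>p\<^sub>p\<close> and \<open>e\<^sub>0\<^sub>0\<close> are the two products of \<open>e\<^sub>p\<^sub>0\<close> and \<open>e\<^sub>0\<^sub>p\<close>, and for \<open>p \<noteq> q\<close> the
  products of \<open>e\<^sub>p\<^sub>q\<close> and \<open>e\<^sub>q\<^sub>q\<close> are \<open>e\<^sub>p\<^sub>q\<close> and 0.
\<close>

lemma trace_image:
  assumes "x \<in> M_inf"
  shows "mat_trace (h x) = mat_trace x"
  using assms
proof (induction x rule: M_inf_induct)
  case zero
  show ?case unfolding h_zero ..
next
  case (add A B)
  then have "h A \<in> M_inf" "h B \<in> M_inf"
    using image_M_inf by auto
  with add have "mat_trace (h (A + B)) = mat_trace (A + B)"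
    by (simp add: h_add mat_trace_add)
  then show ?case .
next
  case (unit c p q)
  have cycle: "mat_trace (h (x \<bullet> y)) = mat_trace (h (y \<bullet> x))" if "x \<in> M_inf" "y \<in> M_inf" for x y
  proof -
    have "h x \<in> M_inf" "h y \<in> M_inf"
      using that image_M_inf by auto
    then show ?thesis
      using that by (simp add: h_mult mat_trace_commute M_inf_RCF)
  qed
  have "mat_trace (h (mat_unit p q)) = (if p = q then 1 else 0)"
  proof (cases "p = q")
    case True
    then show ?thesis
      using cycle[of "mat_unit p 0" "mat_unit 0 p"] trace_image_corner
      by (simp add: mat_unit_mult_mat_unit)
  next
    case False
    then show ?thesis
      using cycle[of "mat_unit p q" "mat_unit q q"]
      by (simp add: mat_unit_mult_mat_unit h_zero)
  qed
  then show ?case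
    by (simp add: h_scale mat_trace_scale mat_trace_unit)
qed

end

lemma matrix_algebra_iso_of_alg_isomorphic:
  assumes "matrix_algebra S" "matrix_algebra T"
    and "alg_isomorphic scalars (RCF\<lparr>carrier := S\<rparr>) (RCF\<lparr>carrier := T\<rparr>)"
  shows "\<exists>h. matrix_algebra_iso S T h"
  using assms
  by (auto simp: alg_isomorphic_def alg_hom_def hom_def matrix_algebra_iso_def matrix_algebra_iso_axioms_def)

section \<open>Laurent polynomials\<close>

lemma lookup_smult: "Poly_Mapping.lookup (Poly_Mapping.map ((*) c) p) k = c * Poly_Mapping.lookup p k"
  for c :: "'a::field"
  by (simp add: Poly_Mapping.map.rep_eq when_def)

lemma laurent_alg_simps [simp]:
  "carrier laurent_alg = UNIV" "p \<otimes>\<^bsub>laurent_alg\<^esub> q = p * q" "\<one>\<^bsub>laurent_alg\<^esub> = 1"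
  "p \<oplus>\<^bsub>laurent_alg\<^esub> q = p + q" "\<zero>\<^bsub>laurent_alg\<^esub> = 0"
  "c \<odot>\<^bsub>laurent_alg\<^esub> p = Poly_Mapping.map ((*) c) p"
  by (simp_all add: laurent_alg_def)

text \<open>
  For extremal exponents the hypothesis is automatic, so the highest and the lowest term of a
  product are the products of the highest and of the lowest terms.
\<close>

lemma lookup_mult_unique_pair:
  fixes p q :: "int \<Rightarrow>\<^sub>0 'a::field"
  assumes "\<And>i j. i \<in> Poly_Mapping.keys p \<Longrightarrow> j \<in> Poly_Mapping.keys q \<Longrightarrow> i + j = k + l \<Longrightarrow> i = k"
  shows "Poly_Mapping.lookup (p * q) (k + l) = Poly_Mapping.lookup p k * Poly_Mapping.lookup q l"
proof -
  have inner: "(\<Sum>j. Poly_Mapping.lookup q j when k + l = i + j) = Poly_Mapping.lookup q (k + l - i)" for i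
  proof -
    have "(k + l = i + j) = (j = k + l - i)" for j
      by auto
    then show ?thesis
      by simp
  qed
  have "Poly_Mapping.lookup (p * q) (k + l) =
      (\<Sum>i. Poly_Mapping.lookup p i * Poly_Mapping.lookup q (k + l - i))"
    unfolding lookup_mult inner ..
  also have "\<dots> = (\<Sum>i\<in>{k}. Poly_Mapping.lookup p i * Poly_Mapping.lookup q (k + l - i))"
  proof (rule Sum_any.expand_superset)
    show "{i. Poly_Mapping.lookup p i * Poly_Mapping.lookup q (k + l - i) \<noteq> 0} \<subseteq> {k}"
      using assms[of _ "k + l - _"] by (auto simp: in_keys_iff)
  qed simp
  finally show ?thesis
    by simp
qed

text \<open>
  The highest and the lowest exponents of \<open>p q = 1\<close> are both 0, and both are additive.  Hence
  neither \<open>p\<close> nor \<open>q\<close> can have two different exponents.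
\<close>

lemma laurent_unit:
  fixes p q :: "int \<Rightarrow>\<^sub>0 'a::field"
  assumes "p * q = 1"
  obtains k a b where "p = Poly_Mapping.single k a" "q = Poly_Mapping.single (- k) b" "a * b = 1"
proof -
  have "p \<noteq> 0" "q \<noteq> 0"
    using assms by auto
  then have ne: "Poly_Mapping.keys p \<noteq> {}" "Poly_Mapping.keys q \<noteq> {}"
    by (auto simp: poly_mapping_eq_iff fun_eq_iff in_keys_iff)
  have extremal: "k + l = 0"
    if "k \<in> Poly_Mapping.keys p" "l \<in> Poly_Mapping.keys q"
      and "\<And>i j. i \<in> Poly_Mapping.keys p \<Longrightarrow> j \<in> Poly_Mapping.keys q \<Longrightarrow> i + j = k + l \<Longrightarrow> i = k"
    for k l
  proof -
    have "Poly_Mapping.lookup (p * q) (k + l) \<noteq> 0"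
      using that by (subst lookup_mult_unique_pair) (auto simp: in_keys_iff)
    then show ?thesis
      by (simp add: assms lookup_one when_def split: if_splits)
  qed
  have max: "Max (Poly_Mapping.keys p) + Max (Poly_Mapping.keys q) = 0"
  proof (rule extremal)
    fix i j assume "i \<in> Poly_Mapping.keys p" "j \<in> Poly_Mapping.keys q"
      and "i + j = Max (Poly_Mapping.keys p) + Max (Poly_Mapping.keys q)"
    moreover from this have "i \<le> Max (Poly_Mapping.keys p)" "j \<le> Max (Poly_Mapping.keys q)"
      by simp_all
    ultimately show "i = Max (Poly_Mapping.keys p)"
      by linarith
  qed (use ne in simp_all)
  have min: "Min (Poly_Mapping.keys p) + Min (Poly_Mapping.keys q) = 0"
  proof (rule extremal)
    fix i j assume "i \<in> Poly_Mapping.keys p" "j \<in> Poly_Mapping.keys q"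
      and "i + j = Min (Poly_Mapping.keys p) + Min (Poly_Mapping.keys q)"
    moreover from this have "i \<ge> Min (Poly_Mapping.keys p)" "j \<ge> Min (Poly_Mapping.keys q)"
      by simp_all
    ultimately show "i = Min (Poly_Mapping.keys p)"
      by linarith
  qed (use ne in simp_all)
  define k where "k = Max (Poly_Mapping.keys p)"
  have le: "Min (Poly_Mapping.keys p) \<le> k" "Min (Poly_Mapping.keys q) \<le> Max (Poly_Mapping.keys q)"
    using ne by (simp_all add: k_def)
  have eqs: "Min (Poly_Mapping.keys p) = k" "Min (Poly_Mapping.keys q) = - k" "Max (Poly_Mapping.keys q) = - k"
    using max min le unfolding k_def[symmetric] by linarith+
  have "i = k" if "i \<in> Poly_Mapping.keys p" for i
    using eqs Min_le[OF finite_keys that] Max_ge[OF finite_keys that]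
    unfolding k_def by linarith
  then have p: "p = Poly_Mapping.single k (Poly_Mapping.lookup p k)"
    by (intro poly_mapping_eqI) (auto simp: lookup_single when_def in_keys_iff)
  have "j = - k" if "j \<in> Poly_Mapping.keys q" for j
    using eqs Min_le[OF finite_keys that] Max_ge[OF finite_keys that] by linarith
  then have q: "q = Poly_Mapping.single (- k) (Poly_Mapping.lookup q (- k))"
    by (intro poly_mapping_eqI) (auto simp: lookup_single when_def in_keys_iff)
  have "Poly_Mapping.single 0 (Poly_Mapping.lookup p k * Poly_Mapping.lookup q (- k)) = p * q"
    by (subst p, subst q) (simp add: mult_single)
  then have "Poly_Mapping.lookup p k * Poly_Mapping.lookup q (- k) = 1"
    using assms by (metis lookup_one_zero lookup_single_eq)
  with p q show ?thesis
    by (rule that)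
qed

section \<open>Lifting Laurent polynomials to matrices\<close>

text \<open>
  The family \<open>B\<close> is a linear section, multiplicative modulo finite matrices, of the symbol map
  that is to be constructed.  Independence is likewise required modulo finite matrices; this is
  what makes the symbol unique.
\<close>

locale laurent_lift =
  fixes B :: "int \<Rightarrow> 'a::field infmat"
  assumes B_RCF [simp]: "B k \<in> carrier RCF"
    and B_zero: "B 0 = mat_one"
    and B_mult: "B k \<bullet> B l - B (k + l) \<in> M_inf"
    and B_independent: "finite F \<Longrightarrow> (\<Sum>k\<in>F. mat_scale (c k) (B k)) \<in> M_inf \<Longrightarrow> k \<in> F \<Longrightarrow> c k = 0"
begin

definition lift :: "(int \<Rightarrow>\<^sub>0 'a) \<Rightarrow> 'a infmat" where
  "lift p = (\<Sum>k\<in>Poly_Mapping.keys p. mat_scale (Poly_Mapping.lookup p k) (B k))"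

lemma lift_eq_sum:
  assumes "finite F" "Poly_Mapping.keys p \<subseteq> F"
  shows "lift p = (\<Sum>k\<in>F. mat_scale (Poly_Mapping.lookup p k) (B k))"
  unfolding lift_def by (rule sum.mono_neutral_left) (use assms in \<open>auto simp: in_keys_iff\<close>)

lemma lift_add: "lift (p + q) = lift p + lift q"
proof -
  let ?F = "Poly_Mapping.keys p \<union> Poly_Mapping.keys q"
  have "lift r = (\<Sum>k\<in>?F. mat_scale (Poly_Mapping.lookup r k) (B k))"
    if "Poly_Mapping.keys r \<subseteq> ?F" for r
    using that by (rule lift_eq_sum[rotated]) simp
  from this[of p] this[of q] this[of "p + q"] show ?thesis
    by (simp add: keys_add lookup_add mat_scale_add_left sum.distrib)
qed

lemma lift_smult: "lift (Poly_Mapping.map ((*) c) p) = mat_scale c (lift p)"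
proof -
  have "Poly_Mapping.keys (Poly_Mapping.map ((*) c) p) \<subseteq> Poly_Mapping.keys p"
    by (auto simp: in_keys_iff lookup_smult)
  then have "lift (Poly_Mapping.map ((*) c) p) =
      (\<Sum>k\<in>Poly_Mapping.keys p. mat_scale (c * Poly_Mapping.lookup p k) (B k))"
    by (subst lift_eq_sum) (simp_all add: lookup_smult)
  then show ?thesis
    by (simp add: lift_def mat_scale_sum)
qed

lemma lift_single: "lift (Poly_Mapping.single k a) = mat_scale a (B k)"
  by (subst lift_eq_sum[of "{k}"]) simp_all

lemma lift_zero [simp]: "lift 0 = 0"
  by (simp add: lift_def)

lemma lift_RCF [simp]: "lift p \<in> carrier RCF"
proof -
  have "(\<Sum>k\<in>F. mat_scale (c k) (B k)) \<in> carrier RCF" for c :: "int \<Rightarrow> 'a" and F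
    by (induction F rule: infinite_finite_induct) (simp_all del: pointwise)
  then show ?thesis
    by (simp add: lift_def)
qed

lemma laurent_eq_sum_single:
  "p = (\<Sum>k\<in>Poly_Mapping.keys p. Poly_Mapping.single k (Poly_Mapping.lookup p k))"
  for p :: "int \<Rightarrow>\<^sub>0 'a"
  by (rule poly_mapping_eqI) (simp add: lookup_sum lookup_single when_def in_keys_iff)

lemma laurent_induct [case_names single add]:
  fixes p :: "int \<Rightarrow>\<^sub>0 'a"
  assumes single: "\<And>k a. P (Poly_Mapping.single k a)"
    and add: "\<And>p q. P p \<Longrightarrow> P q \<Longrightarrow> P (p + q)"
  shows "P p"
proof -
  have "P 0"
    using single[of 0 0] by simp
  then have "P (\<Sum>k\<in>F. Poly_Mapping.single k (c k))" for F and c :: "int \<Rightarrow> 'a"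
    by (induction F rule: infinite_finite_induct) (simp_all add: single add)
  then show ?thesis
    by (subst laurent_eq_sum_single)
qed

lemma lift_mult: "lift p \<bullet> lift q - lift (p * q) \<in> M_inf"
proof (induction p rule: laurent_induct)
  case (single k a)
  show ?case
  proof (induction q rule: laurent_induct)
    case (single l b)
    have "mat_scale (a * b) (B k \<bullet> B l - B (k + l)) \<in> M_inf"
      using B_mult by (rule M_inf_scale)
    also have "mat_scale (a * b) (B k \<bullet> B l - B (k + l)) =
        mat_scale (a * b) (B k \<bullet> B l) - mat_scale (a * b) (B (k + l))"
      by (simp add: mat_scale_def fun_eq_iff algebra_simps)
    finally show ?case
      by (simp add: lift_single mult_single mult.commute)
  next
    case (add p q)
    from M_inf_add[OF add] show ?case
      by (simp add: distrib_left lift_add mat_mult_add_right algebra_simps del: pointwise)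
  qed
next
  case (add p p')
  from M_inf_add[OF add] show ?case
    by (simp add: distrib_right lift_add mat_mult_add_left algebra_simps del: pointwise)
qed

lemma lift_M_inf:
  assumes "lift p \<in> M_inf"
  shows "p = 0"
proof (rule poly_mapping_eqI)
  fix k
  show "Poly_Mapping.lookup p k = Poly_Mapping.lookup 0 k"
    using B_independent[of "Poly_Mapping.keys p" "Poly_Mapping.lookup p" k] assms
    by (cases "k \<in> Poly_Mapping.keys p") (auto simp: lift_def in_keys_iff)
qed

definition has_symbol :: "'a infmat \<Rightarrow> (int \<Rightarrow>\<^sub>0 'a) \<Rightarrow> bool" where
  "has_symbol x p \<longleftrightarrow> x - lift p \<in> M_inf"

lemma has_symbol_iff: "has_symbol x p \<longleftrightarrow> (\<exists>m\<in>M_inf. x = m + lift p)"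
  unfolding has_symbol_def
proof
  assume "x - lift p \<in> M_inf"
  then show "\<exists>m\<in>M_inf. x = m + lift p"
    by (intro bexI[of _ "x - lift p"]) simp_all
qed auto

lemma has_symbol_RCF: "has_symbol x p \<Longrightarrow> x \<in> carrier RCF"
  by (auto simp: has_symbol_iff M_inf_RCF)

lemma has_symbol_lift: "has_symbol (lift p) p"
  by (simp add: has_symbol_def)

lemma has_symbol_zero_iff: "has_symbol x 0 \<longleftrightarrow> x \<in> M_inf"
  by (simp add: has_symbol_def)

lemma has_symbol_one: "has_symbol mat_one 1"
  using has_symbol_lift[of 1] lift_single[of 0 1] by (simp add: B_zero)

lemma has_symbol_unique:
  assumes "has_symbol x p" "has_symbol x q"
  shows "p = q"
proof -
  have "(x - lift q) - (x - lift p) \<in> M_inf"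
    using assms M_inf_diff unfolding has_symbol_def by blast
  also have "(x - lift q) - (x - lift p) = lift (p - q)"
    using lift_add[of "p - q" q] by simp
  finally show ?thesis
    using lift_M_inf by fastforce
qed

lemma has_symbol_add: "has_symbol x p \<Longrightarrow> has_symbol y q \<Longrightarrow> has_symbol (x + y) (p + q)"
  using M_inf_add[of "x - lift p" "y - lift q"]
  by (simp add: has_symbol_def lift_add algebra_simps)

lemma has_symbol_scale: "has_symbol x p \<Longrightarrow> has_symbol (mat_scale c x) (Poly_Mapping.map ((*) c) p)"
  by (force simp: has_symbol_iff lift_smult mat_scale_add)

lemma has_symbol_mult:
  assumes "has_symbol x p" "has_symbol y q"
  shows "has_symbol (x \<bullet> y) (p * q)"
proof -
  note [simp] = has_symbol_RCF[OF assms(1)] has_symbol_RCF[OF assms(2)]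
  have "x \<bullet> y - lift (p * q) = (x - lift p) \<bullet> y + lift p \<bullet> (y - lift q) + (lift p \<bullet> lift q - lift (p * q))"
    by (simp add: mat_mult_diff_left mat_mult_diff_right)
  also have "\<dots> \<in> M_inf"
    using assms lift_mult unfolding has_symbol_def by (intro M_inf_add) simp_all
  finally show ?thesis
    by (simp add: has_symbol_def)
qed

definition T :: "'a infmat set" where
  "T = {x. \<exists>p. has_symbol x p}"

sublocale matrix_algebra T
proof
  show "T \<subseteq> carrier RCF"
    by (auto simp: T_def has_symbol_RCF)
  show "M_inf \<subseteq> T"
    using has_symbol_zero_iff by (auto simp: T_def)
  show "mat_one \<in> T"
    using has_symbol_one by (auto simp: T_def)
qed (auto simp: T_def intro: has_symbol_add has_symbol_mult has_symbol_scale)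

definition symbol :: "'a infmat \<Rightarrow> (int \<Rightarrow>\<^sub>0 'a)" where
  "symbol x = (THE p. has_symbol x p)"

lemma symbol_eq: "has_symbol x p \<Longrightarrow> symbol x = p"
  unfolding symbol_def using has_symbol_unique by blast

lemma has_symbol_symbol: "x \<in> T \<Longrightarrow> has_symbol x (symbol x)"
  using symbol_eq by (auto simp: T_def)

lemma short_exact_symbol: "short_exact scalars M_inf_alg id alg symbol laurent_alg"
proof -
  have "id \<in> alg_hom scalars M_inf_alg alg"
    by (auto simp: alg_hom_def hom_def M_inf_alg_def)
  moreover have "symbol \<in> alg_hom scalars alg laurent_alg"
    unfolding alg_hom_def hom_def
    by (auto intro!: symbol_eq has_symbol_add has_symbol_mult has_symbol_scale has_symbol_symbol)
  moreover have "id ` carrier M_inf_alg = a_kernel alg laurent_alg symbol"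
  proof -
    have "x \<in> M_inf \<longleftrightarrow> x \<in> T \<and> symbol x = 0" for x
      using has_symbol_symbol[of x] symbol_eq[of x 0] M_inf_sub by (auto simp: has_symbol_zero_iff)
    then show ?thesis
      by (auto simp: a_kernel_def' M_inf_alg_def)
  qed
  moreover have "symbol ` carrier alg = carrier laurent_alg"
  proof -
    have "lift p \<in> T \<and> symbol (lift p) = p" for p
      using has_symbol_lift symbol_eq by (auto simp: T_def)
    then show ?thesis
      by (auto simp: image_iff) metis
  qed
  ultimately show ?thesis
    by (simp add: short_exact_def)
qed

lemma span_range_B: "Modules.module.span mat_scale (range B) = range lift"
proof -
  interpret vs: vector_space "mat_scale :: 'a \<Rightarrow> 'a infmat \<Rightarrow> 'a infmat"
    by unfold_locales (simp_all add: mat_scale_add mat_scale_add_left)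
  show ?thesis
  proof
    have "vs.subspace (range lift)"
      unfolding vs.subspace_def
      by (auto simp flip: lift_add lift_smult intro: range_eqI[of _ _ 0])
    moreover have "range B \<subseteq> range lift"
      using lift_single[of _ 1] by (auto intro: range_eqI[of _ _ "Poly_Mapping.single _ 1"])
    ultimately show "vs.span (range B) \<subseteq> range lift"
      by (rule vs.span_minimal[rotated])
    show "range lift \<subseteq> vs.span (range B)"
    proof clarify
      fix p
      show "lift p \<in> vs.span (range B)"
        unfolding lift_def by (intro vs.span_sum vs.span_scale vs.span_base) (rule rangeI)
    qed
  qed
qed

lemma T_eq: "T = M_inf <+>\<^bsub>RCF\<^esub> Modules.module.span mat_scale (range B)"
  unfolding span_range_B set_add_def' T_def has_symbol_iff by auto

end

section \<open>The trace of a commutator\<close>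

text \<open>
  Replacing \<open>x\<close> by \<open>u\<close> and then \<open>y\<close> by \<open>v\<close> changes the commutator by commutators with a
  finite matrix, whose trace is 0.
\<close>

lemma mat_trace_commutator:
  assumes "x - u \<in> M_inf" "y - v \<in> M_inf" and [simp]: "x \<in> carrier RCF" "u \<in> carrier RCF"
      "y \<in> carrier RCF" "v \<in> carrier RCF"
    and uv: "u \<bullet> v - v \<bullet> u \<in> M_inf"
  shows "mat_trace (x \<bullet> y - y \<bullet> x) = mat_trace (u \<bullet> v - v \<bullet> u)"
proof -
  define d e where "d = x - u" and "e = y - v"
  have [simp]: "d \<in> M_inf" "e \<in> M_inf"
    using assms by (simp_all add: d_def e_def)
  then have [simp]: "d \<in> carrier RCF" "e \<in> carrier RCF"
    by (simp_all only: M_inf_RCF)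
  have split: "x \<bullet> y - y \<bullet> x = (d \<bullet> y - y \<bullet> d) + ((u \<bullet> e - e \<bullet> u) + (u \<bullet> v - v \<bullet> u))"
    by (simp add: d_def e_def mat_mult_diff_left mat_mult_diff_right)
  have "mat_trace (d \<bullet> y - y \<bullet> d) = 0" "mat_trace (u \<bullet> e - e \<bullet> u) = 0"
    using mat_trace_commute[of d y] mat_trace_commute[of e u] by (simp_all add: mat_trace_diff)
  then show ?thesis
    unfolding split using uv by (simp add: mat_trace_add)
qed

text \<open>
  The trace condition says that \<open>B 1\<close> has index \<open>- n\<close> and that the index is additive along the
  family.  All \<open>k\<close> occur, because the degree of an invertible symbol can have either sign.
\<close>

locale indexed_lift = laurent_lift +
  fixes n :: nat
  assumes B_inverse: "B (- 1) \<bullet> B 1 = mat_one"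
    and B_trace: "mat_trace (B (- k) \<bullet> B k - B k \<bullet> B (- k)) = of_int (k * int n)"
begin

text \<open>
  The symbols of \<open>x\<close> and \<open>y\<close> are mutually inverse, so they are \<open>a t\<^sup>k\<close> and \<open>b t\<^sup>-\<^sup>k\<close> with
  \<open>a b = 1\<close>, and the trace may be computed on \<open>a B k\<close> and \<open>b B (- k)\<close>.
\<close>

lemma index_multiple:
  assumes "x \<in> T" "y \<in> T" "y \<bullet> x = mat_one"
  shows "\<exists>k. mat_trace (y \<bullet> x - x \<bullet> y) = of_int (k * int n)"
proof -
  obtain p q where p: "has_symbol x p" and q: "has_symbol y q"
    using assms by (auto simp: T_def)
  have "has_symbol mat_one (q * p)"
    using has_symbol_mult[OF q p] assms(3) by simp
  then have "p * q = 1"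
    using has_symbol_unique[OF has_symbol_one] by (metis mult.commute)
  then obtain k a b where kab: "p = Poly_Mapping.single k a" "q = Poly_Mapping.single (- k) b" "a * b = 1"
    by (rule laurent_unit)
  define C where "C = B (- k) \<bullet> B k - B k \<bullet> B (- k)"
  have uv: "mat_scale b (B (- k)) \<bullet> mat_scale a (B k) - mat_scale a (B k) \<bullet> mat_scale b (B (- k)) = C"
    using kab(3) by (simp add: C_def mult.commute)
  have "(B (- k) \<bullet> B k - B (- k + k)) - (B k \<bullet> B (- k) - B (k + - k)) \<in> M_inf"
    by (rule M_inf_diff[OF B_mult B_mult])
  then have "C \<in> M_inf"
    by (simp add: C_def)
  moreover have "x - mat_scale a (B k) \<in> M_inf" "y - mat_scale b (B (- k)) \<in> M_inf"
    using p q by (simp_all add: has_symbol_def kab lift_single)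
  ultimately have "mat_trace (y \<bullet> x - x \<bullet> y) = mat_trace C"
    using mat_trace_commutator[of y "mat_scale b (B (- k))" x "mat_scale a (B k)"] uv assms(1,2)
    by simp
  then show ?thesis
    using B_trace[of k] by (auto simp: C_def)
qed

lemma index_attained:
  "\<exists>x\<in>T. \<exists>y\<in>T. y \<bullet> x = mat_one \<and> y \<bullet> x - x \<bullet> y \<in> M_inf \<and>
     mat_trace (y \<bullet> x - x \<bullet> y) = of_nat n"
proof -
  have "B k \<in> T" for k
    using has_symbol_lift[of "Poly_Mapping.single k 1"] by (auto simp: T_def lift_single)
  then have "B 1 \<in> T" "B (- 1) \<in> T"
    by blast+
  moreover have "(B (- 1) \<bullet> B 1 - B (- 1 + 1)) - (B 1 \<bullet> B (- 1) - B (1 + - 1)) \<in> M_inf"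
    by (rule M_inf_diff[OF B_mult B_mult])
  then have "B (- 1) \<bullet> B 1 - B 1 \<bullet> B (- 1) \<in> M_inf"
    by simp
  moreover have "mat_trace (B (- 1) \<bullet> B 1 - B 1 \<bullet> B (- 1)) = of_nat n"
    using B_trace[of 1] by simp
  ultimately show ?thesis
    using B_inverse by blast
qed

end

text \<open>
  The pair that attains \<open>m\<close> is mapped to a pair of the same kind with the same trace, which has to
  be a multiple of \<open>n\<close>.
\<close>

lemma index_dvd_of_iso:
  fixes B C :: "int \<Rightarrow> 'a::field_char_0 infmat"
  assumes "indexed_lift B m" "indexed_lift C n"
    and "matrix_algebra_iso (laurent_lift.T B) (laurent_lift.T C) h"
  shows "n dvd m"
proof -
  interpret B: indexed_lift B m by fact
  interpret C: indexed_lift C n by fact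
  interpret matrix_algebra_iso B.T C.T h by fact
  obtain x y where xy: "x \<in> B.T" "y \<in> B.T" "y \<bullet> x = mat_one" "y \<bullet> x - x \<bullet> y \<in> M_inf"
      and tr: "mat_trace (y \<bullet> x - x \<bullet> y) = of_nat m"
    using B.index_attained by blast
  have "h y \<bullet> h x = mat_one"
    using xy h_mult[of y x] by (simp add: h_one)
  then obtain k where "mat_trace (h y \<bullet> h x - h x \<bullet> h y) = of_int (k * int n)"
    using C.index_multiple[of "h x" "h y"] xy(1,2) h_mem by blast
  moreover have "h y \<bullet> h x - h x \<bullet> h y = h (y \<bullet> x - x \<bullet> y)"
    using xy(1,2) by (simp add: h_diff h_mult B.mult_mem)
  ultimately have "(of_nat m :: 'a) = of_int (k * int n)"
    using trace_image[OF xy(4)] tr by simp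
  then have "int m = k * int n"
    by (metis of_int_eq_iff of_int_of_nat_eq)
  then show ?thesis
    by (metis dvd_triv_right int_dvd_int_iff)
qed

section \<open>The two families\<close>

lemma shift_RCF [simp]: "shift n \<in> carrier RCF"
proof -
  have "finite {j. int i = n + int j}" for i
    by (rule finite_subset[of _ "{nat (int i - n)}"]) auto
  moreover have "finite {i. int i = n + int j}" for j
    by (rule finite_subset[of _ "{nat (n + int j)}"]) auto
  ultimately show ?thesis
    by (simp add: RCF_iff shift_def)
qed

text \<open>
  The condition \<open>b + j \<ge> 0\<close> records that \<open>shift b\<close> kills the basis vectors that it would move
  to a negative position; it is the only obstruction to \<open>shift\<close> being multiplicative.
\<close>

lemma shift_mult:
  "shift a \<bullet> shift b = (\<lambda>i j. if int i = a + b + int j \<and> b + int j \<ge> 0 then 1 else 0)"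
proof (intro ext)
  fix i j
  have "(shift a \<bullet> shift b) i j = (\<Sum>k\<in>{nat (b + int j)}. shift a i k * shift b k j :: 'a::field)"
    by (rule mat_mult_eq_sum) (simp_all, auto simp: shift_def)
  also have "\<dots> = (if int i = a + b + int j \<and> b + int j \<ge> 0 then 1 else 0)"
    by (auto simp: shift_def)
  finally show "(shift a \<bullet> shift b) i j = (if int i = a + b + int j \<and> b + int j \<ge> 0 then 1 else 0 :: 'a)" .
qed

lemma shift_mult_M_inf: "shift a \<bullet> shift b - shift (a + b) \<in> M_inf"
  unfolding M_inf_iff_bound
proof (intro exI allI impI)
  fix i j
  assume "(shift a \<bullet> shift b - shift (a + b)) i j \<noteq> (0 :: 'a)"
  then have "(if int i = a + b + int j \<and> b + int j \<ge> 0 then 1 else 0) \<noteq> (shift (a + b) i j :: 'a)"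
    by (simp add: shift_mult)
  then have "int i = a + b + int j" "b + int j < 0"
    by (auto simp: shift_def split: if_splits)
  then show "i < nat (\<bar>a\<bar> + \<bar>b\<bar>) \<and> j < nat (\<bar>a\<bar> + \<bar>b\<bar>)"
    by linarith
qed

lemma shift_independent:
  fixes c :: "int \<Rightarrow> 'a::field"
  assumes "n > 0" "finite F" "(\<Sum>k\<in>F. mat_scale (c k) (shift (k * int n))) \<in> M_inf" "k \<in> F"
  shows "c k = 0"
proof -
  let ?A = "\<Sum>k\<in>F. mat_scale (c k) (shift (k * int n))"
  obtain N where N: "\<forall>i j. ?A i j \<noteq> 0 \<longrightarrow> i < N \<and> j < N"
    using assms(3) unfolding M_inf_iff_bound ..
  define j where "j = N + nat \<bar>k * int n\<bar>"
  define i where "i = nat (k * int n + int j)"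
  have ij: "int i = k * int n + int j"
    by (simp add: i_def j_def)
  have "?A i j = (\<Sum>l\<in>F. if l = k then c k else 0)"
    unfolding sum_infmat_apply
    by (rule sum.cong) (use \<open>n > 0\<close> in \<open>auto simp: mat_scale_def shift_def ij\<close>)
  also have "\<dots> = c k"
    using assms(2,4) by simp
  finally show ?thesis
    using N by (metis j_def le_add1 leD)
qed

text \<open>
  One of the two products is the identity, the other one the projection that omits the first
  \<open>\<bar>a\<bar>\<close> basis vectors; the sign of \<open>a\<close> decides which.
\<close>

lemma shift_trace: "mat_trace (shift (- a) \<bullet> shift a - shift a \<bullet> shift (- a)) = of_int a"
proof -
  let ?C = "shift (- a) \<bullet> shift a - shift a \<bullet> shift (- a) :: 'a::field infmat"
  have diag: "?C i i = (if i < nat \<bar>a\<bar> then of_int (sgn a) else 0)" for i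
    by (auto simp: shift_mult sgn_if)
  have "mat_trace ?C = (\<Sum>i<nat \<bar>a\<bar>. ?C i i)"
    by (rule mat_trace_eq_sum) (simp_all only: diag, auto)
  also have "\<dots> = of_nat (nat \<bar>a\<bar>) * of_int (sgn a)"
    unfolding diag by simp
  also have "\<dots> = of_int (int (nat \<bar>a\<bar>) * sgn a)"
    by simp
  also have "int (nat \<bar>a\<bar>) * sgn a = a"
    by (simp add: abs_mult_sgn)
  finally show ?thesis .
qed

lemma indexed_lift_shift:
  assumes "n > 0"
  shows "indexed_lift (\<lambda>k. shift (k * int n) :: 'a::field infmat) n"
proof
  show "shift (0 * int n) = (mat_one :: 'a infmat)"
    by (auto simp: shift_def mat_one_def fun_eq_iff)
  show "shift (k * int n) \<bullet> shift (l * int n) - shift ((k + l) * int n) \<in> (M_inf :: 'a infmat set)" for k l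
    using shift_mult_M_inf[of "k * int n" "l * int n"] by (simp add: distrib_right)
  show "shift (- 1 * int n) \<bullet> shift (1 * int n) = (mat_one :: 'a infmat)"
    by (auto simp: shift_mult mat_one_def fun_eq_iff)
  show "mat_trace (shift (- k * int n) \<bullet> shift (k * int n) - shift (k * int n) \<bullet> shift (- k * int n)) =
      (of_int (k * int n) :: 'a)" for k
    using shift_trace[of "k * int n"] by simp
qed (use shift_independent[OF assms] in simp_all)

lemma D2_pow_RCF [simp]: "D2_pow k \<in> carrier RCF"
  by (simp add: RCF_iff D2_pow_def)

lemma D2_pow_mult: "D2_pow a \<bullet> D2_pow b = (D2_pow (a + b) :: 'a::field_char_0 infmat)"
proof (intro ext)
  fix i j
  have "(D2_pow a \<bullet> D2_pow b) i j = (\<Sum>k\<in>{i}. D2_pow a i k * D2_pow b k j :: 'a)"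
    by (rule mat_mult_eq_sum) (simp_all, simp add: D2_pow_def)
  then show "(D2_pow a \<bullet> D2_pow b) i j = (D2_pow (a + b) i j :: 'a)"
    by (simp add: D2_pow_def power_int_add distrib_right)
qed

text \<open>
  Induction on the number of ratios: combining the relations for \<open>i + 1\<close> and \<open>i\<close> eliminates the
  ratio \<open>r l\<close> and multiplies the other coefficients by \<open>r k - r l \<noteq> 0\<close>.  Only large \<open>i\<close>
  are available, because a finite matrix is unconstrained in its first rows.
\<close>

lemma geometric_independent:
  fixes r c :: "'b \<Rightarrow> 'a::field"
  assumes "finite F" "inj_on r F" "\<And>k. k \<in> F \<Longrightarrow> r k \<noteq> 0"
    and "\<And>i. i \<ge> N \<Longrightarrow> (\<Sum>k\<in>F. c k * r k ^ i) = 0"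
    and "k \<in> F"
  shows "c k = 0"
  using assms
proof (induction F arbitrary: c k rule: finite_induct)
  case (insert l F)
  have "(\<Sum>k\<in>F. (c k * (r k - r l)) * r k ^ i) = 0" if "i \<ge> N" for i
  proof -
    have "(\<Sum>k\<in>insert l F. (c k * (r k - r l)) * r k ^ i) =
        (\<Sum>k\<in>insert l F. c k * r k ^ Suc i) - r l * (\<Sum>k\<in>insert l F. c k * r k ^ i)"
      unfolding sum_distrib_left sum_subtractf[symmetric]
      by (rule sum.cong) (simp_all add: algebra_simps)
    also have "\<dots> = 0"
      using insert.prems(3)[of i] insert.prems(3)[of "Suc i"] that by simp
    finally show ?thesis
      using insert.hyps by simp
  qed
  then have step: "c k * (r k - r l) = 0" if "k \<in> F" for k
    using insert.IH[of "\<lambda>k. c k * (r k - r l)" k] insert.prems(1,2) that by (auto simp: inj_on_insert)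
  have F: "c k = 0" if "k \<in> F" for k
  proof -
    have "r k \<noteq> r l"
      using insert.prems(1) insert.hyps that by (auto simp: inj_on_def)
    then show ?thesis
      using step[OF that] by simp
  qed
  then have "c l * r l ^ N = 0"
    using insert.prems(3)[of N] insert.hyps by simp
  then have "c l = 0"
    using insert.prems(2)[of l] by simp
  with F insert.prems(4) show ?case
    by blast
qed simp

lemma inj_power_int_two: "inj (\<lambda>k. 2 powi k :: 'a::field_char_0)"
proof -
  have neq: "(2 :: 'a) powi k \<noteq> 2 powi l" if "k < l" for k l
  proof
    assume "(2 :: 'a) powi k = 2 powi l"
    then have "(2 :: 'a) powi (l - k) = 1"
      by (simp add: power_int_diff)
    then have "(2 :: 'a) ^ nat (l - k) = 1"
      using that by (simp add: power_int_def)
    then have "of_nat (2 ^ nat (l - k)) = (of_nat 1 :: 'a)"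
      by simp
    then have "(2 :: nat) ^ nat (l - k) = 1"
      by (simp only: of_nat_eq_iff)
    then show False
      using that by simp
  qed
  show ?thesis
    by (rule injI) (metis linorder_neqE neq)
qed

lemma D2_pow_independent:
  fixes c :: "int \<Rightarrow> 'a::field_char_0"
  assumes "finite F" "(\<Sum>k\<in>F. mat_scale (c k) (D2_pow k)) \<in> M_inf" "k \<in> F"
  shows "c k = 0"
proof -
  obtain N where N: "\<forall>i j. (\<Sum>k\<in>F. mat_scale (c k) (D2_pow k)) i j \<noteq> 0 \<longrightarrow> i < N \<and> j < N"
    using assms(2) unfolding M_inf_iff_bound ..
  show ?thesis
  proof (rule geometric_independent[OF assms(1) _ _ _ assms(3)])
    show "inj_on (\<lambda>k. 2 powi k :: 'a) F"
      using inj_power_int_two by (rule inj_on_subset) simp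
    fix i assume "i \<ge> N"
    then have "(\<Sum>k\<in>F. mat_scale (c k) (D2_pow k)) i i = 0"
      using N by (metis leD)
    then show "(\<Sum>k\<in>F. c k * (2 powi k) ^ i) = 0"
      by (simp add: sum_infmat_apply mat_scale_def D2_pow_def power_int_power')
  qed simp
qed

lemma indexed_lift_D2: "indexed_lift (D2_pow :: int \<Rightarrow> 'a::field_char_0 infmat) 0"
proof
  show "D2_pow 0 = (mat_one :: 'a infmat)"
    by (simp add: D2_pow_def mat_one_def fun_eq_iff)
  then show "D2_pow (- 1) \<bullet> D2_pow 1 = (mat_one :: 'a infmat)"
    by (simp add: D2_pow_mult)
qed (use D2_pow_independent in \<open>simp_all add: D2_pow_mult\<close>)

definition T_family :: "nat \<Rightarrow> int \<Rightarrow> 'a::field infmat" where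
  "T_family n = (if n = 0 then D2_pow else (\<lambda>k. shift (k * int n)))"

lemma indexed_lift_T_family: "indexed_lift (T_family n :: int \<Rightarrow> 'a::field_char_0 infmat) n"
  using indexed_lift_D2 indexed_lift_shift[of n] by (cases "n = 0") (simp_all add: T_family_def)

lemma T_alg_eq:
  "T_alg n = RCF\<lparr>carrier := laurent_lift.T (T_family n :: int \<Rightarrow> 'a::field_char_0 infmat)\<rparr>"
proof -
  interpret indexed_lift "T_family n :: int \<Rightarrow> 'a infmat" n
    by (rule indexed_lift_T_family)
  show ?thesis
    unfolding T_alg_def T_eq by (simp add: T_family_def)
qed

theorem mainTheorem3:
  shows "(\<forall>i. carrier (T_alg i :: ('a::field_char_0, 'a infmat) module) \<subseteq> carrier RCF \<and>
              assoc_algebra (ring_of_type_algebra :: 'a ring) (T_alg i) \<and>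
              faithful_ideal (ring_of_type_algebra :: 'a ring) M_inf (T_alg i) \<and>
              (\<exists>\<pi>. short_exact (ring_of_type_algebra :: 'a ring)
                      M_inf_alg id (T_alg i) \<pi> laurent_alg)) \<and>
         (\<forall>i j. i \<noteq> j \<longrightarrow>
              \<not> alg_isomorphic (ring_of_type_algebra :: 'a ring)
                  (T_alg i :: ('a, 'a infmat) module) (T_alg j :: ('a, 'a infmat) module))"
proof (intro conjI allI impI notI)
  fix i
  interpret indexed_lift "T_family i :: int \<Rightarrow> 'a infmat" i
    by (rule indexed_lift_T_family)
  show "carrier (T_alg i :: ('a, 'a infmat) module) \<subseteq> carrier RCF"
    using sub_RCF by (simp add: T_alg_eq)
  show "assoc_algebra scalars (T_alg i :: ('a, 'a infmat) module)"
    using assoc_algebra by (simp only: T_alg_eq)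
  show "faithful_ideal scalars M_inf (T_alg i :: ('a, 'a infmat) module)"
    using faithful_M_inf by (simp only: T_alg_eq)
  show "\<exists>\<pi>. short_exact scalars M_inf_alg id (T_alg i :: ('a, 'a infmat) module) \<pi> laurent_alg"
    using short_exact_symbol unfolding T_alg_eq by blast
next
  fix i j :: nat
  assume "i \<noteq> j"
    and iso: "alg_isomorphic scalars (T_alg i :: ('a, 'a infmat) module) (T_alg j)"
  interpret I: indexed_lift "T_family i :: int \<Rightarrow> 'a infmat" i
    by (rule indexed_lift_T_family)
  interpret J: indexed_lift "T_family j :: int \<Rightarrow> 'a infmat" j
    by (rule indexed_lift_T_family)
  obtain h where h: "matrix_algebra_iso I.T J.T h"
    using matrix_algebra_iso_of_alg_isomorphic[OF I.matrix_algebra_axioms J.matrix_algebra_axioms] iso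
    unfolding T_alg_eq by blast
  have "j dvd i"
    using indexed_lift_T_family indexed_lift_T_family h by (rule index_dvd_of_iso)
  moreover have "i dvd j"
    using indexed_lift_T_family indexed_lift_T_family matrix_algebra_iso.inverse[OF h]
    by (rule index_dvd_of_iso)
  ultimately show False
    using \<open>i \<noteq> j\<close> by (simp add: dvd_antisym)
qed

end
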